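(* Let $C$ be a nonempty closed convex subset of a real Hilbert space $H$. Let $\{f_i\}_{i=1}^N$ be a finite family of bifunctions on $C$ satisfying conditions A1--A4 (listed in the context), with A2 holding with common constants $c_1,c_2>0$, and let $\{S_j\}_{j=1}^M$ be a finite family of nonexpansive mappings $S_j:C\to C$. Suppose that the set $F=\left(\bigcap_{i=1}^N EP(f_i)\right)\cap\left(\bigcap_{j=1}^M F(S_j)\right)$ is nonempty. Let $x_0\in C$, $0<\rho<\min\left\{\frac{1}{2c_1},\frac{1}{2c_2}\right\}$, and let $\{\alpha_{n,l}\}_{n\ge 0}$, $l=0,1,\dots,M$, be positive sequences with $\alpha_{n,l}\le 1$, $\sum_{l=0}^M\alpha_{n,l}=1$ for all $n$, and $\liminf_{n\to\infty}\alpha_{n,0}\alpha_{n,l}>0$ for all $l=1,\dots,M$. If the parallel hybrid iteration-extragradient method (described in the context) does not stop after finitely many iterations, then the infinite sequence $\{x_n\}$ it generates converges strongly to $x^\dagger=P_F x_0$.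
   Context: A bifunction on $C$ is a function $f:C\times C\to\mathbb{R}\cup\{+\infty\}$ with $f(x,x)=0$ for all $x\in C$. $EP(f)=\{x^*\in C: f(x^*,y)\ge 0\ \forall y\in C\}$. A mapping $S:C\to C$ is nonexpansive if $\|Sx-Sy\|\le\|x-y\|$ for all $x,y\in C$; $F(S)$ is its set of fixed points. $P_D$ denotes the metric projection onto a nonempty closed convex set $D$. Conditions on a bifunction $f$: A1. $f$ is pseudomonotone: for all $x,y\in C$, $f(x,y)\ge 0\Rightarrow f(y,x)\le 0$. A2. $f$ is Lipschitz-type continuous: there are constants $c_1,c_2>0$ such that $f(x,y)+f(y,z)\ge f(x,z)-c_1\|x-y\|^2-c_2\|y-z\|^2$ for all $x,y,z\in C$. (For a finite family, common constants $c_1,c_2$ are used, obtained by taking maxima.) A3. $f$ is weakly continuous on $C\times C$: if $x_n\rightharpoonup x$ and $y_n\rightharpoonup y$ in $C$, then $f(x_n,y_n)\to f(x,y)$. A4. $f(x,\cdot)$ is convex and subdifferentiable on $C$ for every fixed $x\in C$. Parallel hybrid iteration-extragradient method. Starting with $x_0\in C$, for $n=0,1,2,\dots$: 1. $y_n^i=\operatorname{argmin}\{\rho f_i(x_n,y)+\frac12\|x_n-y\|^2: y\in C\}$, $i=1,\dots,N$. 2. $z_n^i=\operatorname{argmin}\{\rho f_i(y_n^i,y)+\frac12\|x_n-y\|^2: y\in C\}$, $i=1,\dots,N$. 3. Choose $i_n\in\operatorname{argmax}\{\|z_n^i-x_n\|: i=1,\dots,N\}$ and set $\bar z_n:=z_n^{i_n}$.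 4. $u_n^j=S_j\bar z_n$, $j=1,\dots,M$, and $u_n=\alpha_{n,0}x_n+\sum_{j=1}^M\alpha_{n,j}u_n^j$. 5. $C_n=\{v\in C:\|u_n-v\|\le\|x_n-v\|\}$ and $Q_n=\{v\in C:\langle x_0-x_n,v-x_n\rangle\le 0\}$. 6. $x_{n+1}=P_{C_n\cap Q_n}(x_0)$. 7. If $x_{n+1}=x_n$, stop; otherwise continue with $n+1$. *)

theory Defs
  imports "HOL-Analysis.Analysis"
begin

(* Extended values R Un {+oo} are rendered as ereal values different from -oo. *)
definition bifunction_on :: "'a set \<Rightarrow> ('a \<Rightarrow> 'a \<Rightarrow> ereal) \<Rightarrow> bool" where
  "bifunction_on C f \<longleftrightarrow>
     (\<forall>x\<in>C. \<forall>y\<in>C. f x y \<noteq> - \<infinity>) \<and> (\<forall>x\<in>C. f x x = 0)"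

definition EP :: "'a set \<Rightarrow> ('a \<Rightarrow> 'a \<Rightarrow> ereal) \<Rightarrow> 'a set" where
  "EP C f = {x \<in> C. \<forall>y\<in>C. f x y \<ge> 0}"

definition nonexpansive_on :: "'a::real_normed_vector set \<Rightarrow> ('a \<Rightarrow> 'a) \<Rightarrow> bool" where
  "nonexpansive_on C S \<longleftrightarrow> (\<forall>x\<in>C. \<forall>y\<in>C. norm (S x - S y) \<le> norm (x - y))"

definition fixed_points :: "'a set \<Rightarrow> ('a \<Rightarrow> 'a) \<Rightarrow> 'a set" where
  "fixed_points C S = {x \<in> C. S x = x}"

(* The library's closest_point requires the sort heine_borel, i.e. excludes
   infinite-dimensional spaces. *)
definition metric_proj :: "'a::metric_space set \<Rightarrow> 'a \<Rightarrow> 'a" where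
  "metric_proj D a = arg_min_on (\<lambda>v. dist a v) D"

definition weakly_converges :: "(nat \<Rightarrow> 'a::real_inner) \<Rightarrow> 'a \<Rightarrow> bool" where
  "weakly_converges X a \<longleftrightarrow> (\<forall>v. (\<lambda>n. X n \<bullet> v) \<longlonglongrightarrow> a \<bullet> v)"

definition pseudomonotone_on :: "'a set \<Rightarrow> ('a \<Rightarrow> 'a \<Rightarrow> ereal) \<Rightarrow> bool" where
  "pseudomonotone_on C f \<longleftrightarrow> (\<forall>x\<in>C. \<forall>y\<in>C. f x y \<ge> 0 \<longrightarrow> f y x \<le> 0)"

definition lipschitz_type_on ::
    "real \<Rightarrow> real \<Rightarrow> 'a::real_normed_vector set \<Rightarrow> ('a \<Rightarrow> 'a \<Rightarrow> ereal) \<Rightarrow> bool" where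
  "lipschitz_type_on c1 c2 C f \<longleftrightarrow>
     (\<forall>x\<in>C. \<forall>y\<in>C. \<forall>z\<in>C.
        f x y + f y z \<ge> f x z - ereal (c1 * (norm (x - y))\<^sup>2) - ereal (c2 * (norm (y - z))\<^sup>2))"

definition weakly_continuous_on :: "'a::real_inner set \<Rightarrow> ('a \<Rightarrow> 'a \<Rightarrow> ereal) \<Rightarrow> bool" where
  "weakly_continuous_on C f \<longleftrightarrow>
     (\<forall>X Y x y. (\<forall>n. X n \<in> C) \<and> (\<forall>n. Y n \<in> C) \<and> x \<in> C \<and> y \<in> C \<and>
        weakly_converges X x \<and> weakly_converges Y y \<longrightarrow> (\<lambda>n. f (X n) (Y n)) \<longlonglongrightarrow> f x y)"

definition ereal_convex_on :: "'a::real_vector set \<Rightarrow> ('a \<Rightarrow> ereal) \<Rightarrow> bool" where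
  "ereal_convex_on C g \<longleftrightarrow> convex C \<and>
     (\<forall>x\<in>C. \<forall>y\<in>C. \<forall>s\<ge>0. \<forall>t\<ge>0. s + t = 1 \<longrightarrow>
        g (s *\<^sub>R x + t *\<^sub>R y) \<le> ereal s * g x + ereal t * g y)"

definition subdifferential :: "'a::real_inner set \<Rightarrow> ('a \<Rightarrow> ereal) \<Rightarrow> 'a \<Rightarrow> 'a set" where
  "subdifferential C g y = {w. \<forall>z\<in>C. g z \<ge> g y + ereal (w \<bullet> (z - y))}"

definition subdifferentiable_on :: "'a::real_inner set \<Rightarrow> ('a \<Rightarrow> ereal) \<Rightarrow> bool" where
  "subdifferentiable_on C g \<longleftrightarrow> (\<forall>y\<in>C. subdifferential C g y \<noteq> {})"

(* i n is the chosen index of a farthest z n k; the intermediate points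
   S_j (z n (i n)) are written out in the formula for u n.  The stopping test
   is not part of this predicate. *)
definition parallel_hybrid_extragradient ::
    "'a::real_inner set \<Rightarrow> nat \<Rightarrow> nat \<Rightarrow> (nat \<Rightarrow> 'a \<Rightarrow> 'a \<Rightarrow> ereal) \<Rightarrow> (nat \<Rightarrow> 'a \<Rightarrow> 'a) \<Rightarrow>
     real \<Rightarrow> (nat \<Rightarrow> nat \<Rightarrow> real) \<Rightarrow> 'a \<Rightarrow>
     (nat \<Rightarrow> 'a) \<Rightarrow> (nat \<Rightarrow> nat \<Rightarrow> 'a) \<Rightarrow> (nat \<Rightarrow> nat \<Rightarrow> 'a) \<Rightarrow> (nat \<Rightarrow> nat) \<Rightarrow> (nat \<Rightarrow> 'a) \<Rightarrow> bool" where
  "parallel_hybrid_extragradient C N M f S \<rho> \<alpha> x0 x y z i u \<longleftrightarrow>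
     x 0 = x0 \<and>
     (\<forall>n.
       (\<forall>k\<in>{1..N}. is_arg_min (\<lambda>v. ereal \<rho> * f k (x n) v + ereal (1/2 * (norm (x n - v))\<^sup>2))
                      (\<lambda>v. v \<in> C) (y n k)) \<and>
       (\<forall>k\<in>{1..N}. is_arg_min (\<lambda>v. ereal \<rho> * f k (y n k) v + ereal (1/2 * (norm (x n - v))\<^sup>2))
                      (\<lambda>v. v \<in> C) (z n k)) \<and>
       is_arg_max (\<lambda>k. norm (z n k - x n)) (\<lambda>k. k \<in> {1..N}) (i n) \<and>
       u n = \<alpha> n 0 *\<^sub>R x n + (\<Sum>j=1..M. \<alpha> n j *\<^sub>R S j (z n (i n))) \<and>
       x (Suc n) = metric_proj ({v \<in> C. norm (u n - v) \<le> norm (x n - v)} \<inter>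
                                {v \<in> C. (x0 - x n) \<bullet> (v - x n) \<le> 0}) x0)"

end

theory Submission
  imports Defs "HOL-Complex_Analysis.Great_Picard"
begin

text \<open>Strong convexity of the proximal objectives together with pseudomonotonicity and the
  Lipschitz-type condition makes each extragradient step, hence also the Mann average \<open>u n\<close>,
  no farther from any \<open>p \<in> F\<close> than \<open>x n\<close>. So \<open>F\<close> lies in every half-space cut, the distances
  \<open>norm (x n - x 0)\<close> increase to a limit bounded by the distance from \<open>x 0\<close> to \<open>F\<close>, and
  consecutive iterates approach each other; the slack in the estimates then forces
  \<open>x n - y n k\<close> and \<open>x n - S j (x n)\<close> to \<open>0\<close>. Weak cluster points therefore belong to \<open>F\<close>, and
  any one of them, being no farther from \<open>x 0\<close> than the limit of the distances, yields strong
  convergence to the projection.\<close>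

section \<open>Nearest points and metric projections in a Hilbert space\<close>

text \<open>Points \<open>p n\<close> of \<open>K n\<close> that almost realise the distance from
  \<open>a\<close> form a Cauchy sequence, and completeness supplies the limit. A constant
  \<open>K\<close> yields existence of projections; a decreasing one yields the nonempty
  intersection used for weak compactness.\<close>

lemma nested_closed_convex_nearest:
  fixes K :: "nat \<Rightarrow> 'a::{real_inner,complete_space} set"
  assumes clo: "\<And>n. closed (K n)" and cvx: "\<And>n. convex (K n)" and dec: "decseq K"
    and bdd: "\<And>n. K n \<inter> cball a B \<noteq> {}"
  obtains p where "p \<in> (\<Inter>n. K n)" "\<And>v. v \<in> (\<Inter>n. K n) \<Longrightarrow> dist a p \<le> dist a v"
proof -
  define d where "d = (\<lambda>n. infdist a (K n))"
  have ne: "K n \<noteq> {}" for n using bdd[of n] by blast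
  have "d n \<le> B" for n
  proof -
    obtain v where "v \<in> K n" "dist a v \<le> B" using bdd[of n] by auto
    then show ?thesis unfolding d_def using infdist_le2 by blast
  qed
  moreover have "incseq d"
    using dec ne unfolding d_def incseq_def decseq_def by (metis infdist_mono)
  ultimately obtain D where D: "d \<longlonglongrightarrow> D" using incseq_convergent by blast
  have "\<exists>v\<in>K n. dist a v < d n + 1 / real (Suc n)" for n
  proof -
    have "(INF v\<in>K n. dist a v) < d n + 1 / real (Suc n)"
      using ne[of n] by (simp add: d_def infdist_notempty)
    then show ?thesis
      using ne[of n] by (subst (asm) cINF_less_iff) (auto intro!: bdd_belowI2[where m=0])
  qed
  then obtain p where p: "p n \<in> K n" "dist a (p n) < d n + 1 / real (Suc n)" for n by metis
  have dp: "d n \<le> dist a (p n)" for n unfolding d_def using p(1) by (rule infdist_le)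
  have aD: "(\<lambda>n. dist a (p n)) \<longlonglongrightarrow> D"
  proof (rule tendsto_sandwich[OF _ _ D])
    show "(\<lambda>n. d n + 1 / real (Suc n)) \<longlonglongrightarrow> D"
      using tendsto_add[OF D LIMSEQ_Suc[OF lim_1_over_n]] by simp
  qed (use dp p(2) in \<open>auto intro!: always_eventually less_imp_le\<close>)
  \<comment> \<open>Parallelogram law for \<open>a - p n\<close> and \<open>a - p m\<close>: by
    nesting and convexity the midpoint lies in \<open>K n\<close>, so its distance from
    \<open>a\<close> is at least \<open>d n\<close>.\<close>
  have par: "(dist (p n) (p m))\<^sup>2 \<le> 2 * (dist a (p n))\<^sup>2 + 2 * (dist a (p m))\<^sup>2 - 4 * (d n)\<^sup>2"
    if "n \<le> m" for n m
  proof -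
    have "p m \<in> K n" using that dec p(1)[of m] unfolding decseq_def by blast
    then have "(1/2) *\<^sub>R p n + (1/2) *\<^sub>R p m \<in> K n"
      using p(1)[of n] cvx[of n] unfolding convex_def by (simp add: field_simps)
    then have "d n \<le> dist a ((1/2) *\<^sub>R p n + (1/2) *\<^sub>R p m)" unfolding d_def by (rule infdist_le)
    then have "(d n)\<^sup>2 \<le> (dist a ((1/2) *\<^sub>R p n + (1/2) *\<^sub>R p m))\<^sup>2"
      by (rule power_mono) (simp add: d_def infdist_nonneg)
    then show ?thesis
      by (simp add: dist_norm power2_norm_eq_inner inner_diff_left inner_diff_right inner_add_left
          inner_add_right inner_commute algebra_simps)
  qed
  have "Cauchy p"
  proof (rule metric_CauchyI)
    fix e :: real assume e: "0 < e"
    have "(\<lambda>n. (dist a (p n))\<^sup>2) \<longlonglongrightarrow> D\<^sup>2" "(\<lambda>n. (d n)\<^sup>2) \<longlonglongrightarrow> D\<^sup>2"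
      using aD D by (auto intro: tendsto_power)
    \<comment> \<open>With the margin \<open>e\<^sup>2/8\<close> the right-hand side of
      \<open>par\<close> stays below
      \<open>4 * e\<^sup>2/8 + 4 * e\<^sup>2/8 = e\<^sup>2\<close>.\<close>
    then have "\<forall>\<^sub>F n in sequentially. (dist a (p n))\<^sup>2 < D\<^sup>2 + e\<^sup>2/8 \<and> D\<^sup>2 - e\<^sup>2/8 < (d n)\<^sup>2"
      using e by (intro eventually_conj order_tendstoD) auto
    then obtain N where N: "\<And>n. n \<ge> N \<Longrightarrow> (dist a (p n))\<^sup>2 < D\<^sup>2 + e\<^sup>2/8 \<and> D\<^sup>2 - e\<^sup>2/8 < (d n)\<^sup>2"
      unfolding eventually_sequentially by blast
    have close: "dist (p n) (p m) < e" if "N \<le> n" "n \<le> m" for n m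
    proof -
      have "(dist (p n) (p m))\<^sup>2 < e\<^sup>2" using par[OF that(2)] N[of n] N[of m] that by auto
      then show ?thesis using e by (simp add: power_less_imp_less_base)
    qed
    show "\<exists>N. \<forall>m\<ge>N. \<forall>n\<ge>N. dist (p m) (p n) < e"
      by (metis close dist_commute nle_le)
  qed
  then obtain q where q: "p \<longlonglongrightarrow> q" using Cauchy_convergent_iff convergent_def by blast
  have "q \<in> K n" for n
  proof (rule Lim_in_closed_set[OF clo _ _ q])
    show "\<forall>\<^sub>F m in sequentially. p m \<in> K n"
      unfolding eventually_sequentially using p(1) dec unfolding decseq_def by blast
  qed auto
  moreover have "dist a q \<le> dist a v" if "v \<in> (\<Inter>n. K n)" for v
  proof -
    have "dist a q = D" using aD tendsto_dist[OF tendsto_const q] LIMSEQ_unique by blast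
    moreover have "D \<le> dist a v"
      using that by (intro LIMSEQ_le_const2[OF D]) (auto simp: d_def infdist_le)
    ultimately show ?thesis by simp
  qed
  ultimately show ?thesis using that by blast
qed

text \<open>\<open>metric_proj\<close> is a choice among minimisers, so one witness \<open>p\<close>
  suffices. This handles the projection onto \<open>F\<close> through an explicit minimiser, without
  first establishing that \<open>F\<close> is closed and convex.\<close>

lemma metric_proj_minimises:
  assumes "p \<in> D" "\<And>v. v \<in> D \<Longrightarrow> dist a p \<le> dist a v"
  shows "metric_proj D a \<in> D" "\<And>v. v \<in> D \<Longrightarrow> dist a (metric_proj D a) \<le> dist a v"
proof -
  have "is_arg_min (\<lambda>v. dist a v) (\<lambda>v. v \<in> D) p"
    using assms unfolding is_arg_min_linorder by blast
  then have "is_arg_min (\<lambda>v. dist a v) (\<lambda>v. v \<in> D) (metric_proj D a)"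
    unfolding metric_proj_def arg_min_on_def arg_min_def by (rule someI)
  then show "metric_proj D a \<in> D" "\<And>v. v \<in> D \<Longrightarrow> dist a (metric_proj D a) \<le> dist a v"
    unfolding is_arg_min_linorder by blast+
qed

text \<open>At an acute angle, a small move from \<open>p\<close> towards \<open>v\<close>, which
  stays in \<open>D\<close> by convexity, would come closer to \<open>a\<close>.\<close>

lemma convex_nearest_obtuse:
  fixes D :: "'a::real_inner set"
  assumes D: "convex D" and p: "p \<in> D" "\<And>v. v \<in> D \<Longrightarrow> dist a p \<le> dist a v" and v: "v \<in> D"
  shows "(a - p) \<bullet> (v - p) \<le> 0"
proof (rule ccontr)
  assume "\<not> ?thesis"
  then obtain t where t: "0 < t" "t \<le> 1" "dist (p + t *\<^sub>R (v - p)) a < dist p a"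
    using closer_point_lemma[of a p v] by auto
  have "p + t *\<^sub>R (v - p) = (1 - t) *\<^sub>R p + t *\<^sub>R v" by (simp add: algebra_simps)
  then have "p + t *\<^sub>R (v - p) \<in> D" using D p(1) v t by (simp add: convexD_alt)
  then show False using p(2) t(3) by (metis dist_commute not_le)
qed

lemma metric_proj_closed_convex:
  fixes D :: "'a::{real_inner,complete_space} set"
  assumes "closed D" "convex D" "D \<noteq> {}"
  shows "metric_proj D a \<in> D"
    and "\<And>v. v \<in> D \<Longrightarrow> (a - metric_proj D a) \<bullet> (v - metric_proj D a) \<le> 0"
proof -
  obtain w where w: "w \<in> D" using assms by blast
  have "D \<inter> cball a (dist a w) \<noteq> {}" using w by auto
  then obtain p where p: "p \<in> D" "\<And>v. v \<in> D \<Longrightarrow> dist a p \<le> dist a v"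
    using nested_closed_convex_nearest[of "\<lambda>_::nat. D" a "dist a w"] assms
    by (auto simp: decseq_def)
  show "metric_proj D a \<in> D" using metric_proj_minimises[OF p] by blast
  show "(a - metric_proj D a) \<bullet> (v - metric_proj D a) \<le> 0" if "v \<in> D" for v
    using convex_nearest_obtuse[OF assms(2) metric_proj_minimises[OF p] that] .
qed

section \<open>Weak convergence in a Hilbert space\<close>

text \<open>The obtuse-angle inequality at the projection \<open>q\<close> of \<open>p\<close> is
  affine in \<open>X n\<close>, so it survives the weak limit, where it forces
  \<open>p = q\<close>.\<close>

lemma weakly_converges_closed_convex:
  fixes C :: "'a::{real_inner,complete_space} set"
  assumes C: "closed C" "convex C" and X: "\<And>n. X n \<in> C" and lim: "weakly_converges X p"
  shows "p \<in> C"
proof -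
  define q where "q = metric_proj C p"
  have "C \<noteq> {}" using X by blast
  note q = metric_proj_closed_convex[OF C this, where a=p, folded q_def]
  have "(\<lambda>n. (p - q) \<bullet> (X n - q)) \<longlonglongrightarrow> (p - q) \<bullet> (p - q)"
    using lim unfolding weakly_converges_def inner_diff_right inner_commute[of "p - q"]
    by (auto intro!: tendsto_diff)
  then have "(p - q) \<bullet> (p - q) \<le> 0"
    using q(2)[OF X] by (intro LIMSEQ_le_const2) auto
  then have "p = q" by (metis inner_eq_zero_iff inner_ge_zero nle_le right_minus_eq)
  then show ?thesis using q(1) by simp
qed

text \<open>The functionals given by \<open>e n\<close> share the Lipschitz constant
  \<open>B\<close>, so replacing \<open>w\<close> by a nearby \<open>W k\<close> costs an error that
  is small uniformly in \<open>n\<close>.\<close>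

lemma closed_inner_null_directions:
  fixes e :: "nat \<Rightarrow> 'a::real_inner"
  assumes "\<And>n. norm (e n) \<le> B"
  shows "closed {w. (\<lambda>n. e n \<bullet> w) \<longlonglongrightarrow> 0}"
proof (unfold closed_sequential_limits, safe)
  fix W w assume W: "\<forall>k. W k \<in> {w. (\<lambda>n. e n \<bullet> w) \<longlonglongrightarrow> 0}" and lim: "W \<longlonglongrightarrow> w"
  have B: "0 \<le> B" using assms[of 0] norm_ge_zero order_trans by blast
  show "(\<lambda>n. e n \<bullet> w) \<longlonglongrightarrow> 0"
  proof (rule LIMSEQ_I)
    fix r :: real assume r: "0 < r"
    then have "0 < r / (2 * (B + 1))" using B by simp
    from LIMSEQ_D[OF lim this] obtain k where k: "norm (W k - w) < r / (2 * (B + 1))" by blast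
    have "(\<lambda>n. e n \<bullet> W k) \<longlonglongrightarrow> 0" using W by blast
    from LIMSEQ_D[OF this, of "r/2"] r
    obtain N where N: "\<And>n. n \<ge> N \<Longrightarrow> \<bar>e n \<bullet> W k\<bar> < r/2" by auto
    have "\<bar>e n \<bullet> w\<bar> < r" if "n \<ge> N" for n
    proof -
      have "e n \<bullet> w = e n \<bullet> W k - e n \<bullet> (W k - w)" by (simp add: inner_diff_right)
      moreover have "\<bar>e n \<bullet> (W k - w)\<bar> \<le> r / 2"
      proof -
        have "\<bar>e n \<bullet> (W k - w)\<bar> \<le> norm (e n) * norm (W k - w)" by (rule Cauchy_Schwarz_ineq2)
        also have "\<dots> \<le> (B + 1) * (r / (2 * (B + 1)))"
          using assms[of n] k B by (intro mult_mono) auto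
        also have "\<dots> = r / 2" using B by (simp add: field_simps)
        finally show ?thesis .
      qed
      ultimately show ?thesis using N[OF that] by linarith
    qed
    then show "\<exists>N. \<forall>n\<ge>N. norm (e n \<bullet> w - 0) < r" by auto
  qed
qed

text \<open>The weak limit is found in the intersection of the closed convex hulls of the tails,
  which avoids the Riesz representation theorem.\<close>

theorem bounded_weakly_convergent_subsequence:
  fixes X :: "nat \<Rightarrow> 'a::{real_inner,complete_space}"
  assumes B: "\<And>n. norm (X n) \<le> B"
  obtains r p where "strict_mono r" "weakly_converges (X \<circ> r) p"
proof -
  \<comment> \<open>Boundedness for each fixed \<open>m\<close> allows a diagonal choice of one
    subsequence along which the inner products with every \<open>X m\<close> converge.\<close>
  have "norm (X n \<bullet> X m) \<le> B * B" for n m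
    using Cauchy_Schwarz_ineq2[of "X n" "X m"] mult_mono[OF B[of n] B[of m]] norm_ge_zero
      order_trans[OF norm_ge_zero B] by fastforce
  from function_convergent_subsequence[of "UNIV :: nat set" "\<lambda>n m. X n \<bullet> X m", OF _ this]
  obtain r :: "nat \<Rightarrow> nat" where r: "strict_mono r"
    and ex: "\<And>m. \<exists>l. (\<lambda>n. X (r n) \<bullet> X m) \<longlonglongrightarrow> l"
    by auto
  define Z where "Z = X \<circ> r"
  define K where "K n = closure (convex hull (Z ` {n..}))" for n
  have ZK: "Z m \<in> K n" if "n \<le> m" for n m
    unfolding K_def using that by (intro subsetD[OF closure_subset] hull_inc) auto
  have K: "closed (K n)" "convex (K n)" for n
    unfolding K_def by (auto simp: convex_closure)
  have dec: "decseq K"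
    unfolding K_def decseq_def by (intro allI impI closure_mono hull_mono image_mono) auto
  have "K n \<inter> cball 0 B \<noteq> {}" for n using ZK[of n n] B by (auto simp: Z_def)
  then obtain p where p: "\<And>n. p \<in> K n"
    using nested_closed_convex_nearest[OF K dec, of 0 B] by (metis INT_E UNIV_I)
  have K_min: "K n \<subseteq> T" if "closed T" "convex T" "\<And>m. n \<le> m \<Longrightarrow> Z m \<in> T" for n T
    unfolding K_def using that by (intro closure_minimal hull_minimal) auto
  \<comment> \<open>\<open>L\<close> collects the directions in which \<open>Z\<close> tends weakly
    to \<open>p\<close>. It turns out to be a closed subspace containing every \<open>X m\<close>
    and \<open>p\<close>.\<close>
  define L where "L = {w. (\<lambda>n. (Z n - p) \<bullet> w) \<longlonglongrightarrow> 0}"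
  have "norm (Z n - p) \<le> B + norm p" for n
    using B[of "r n"] norm_triangle_ineq4[of "Z n" p] by (simp add: Z_def)
  then have clL: "closed L" unfolding L_def by (rule closed_inner_null_directions)
  have subL: "subspace L"
    unfolding subspace_def L_def
    by (auto simp: inner_add_right intro: tendsto_add_zero tendsto_mult_right_zero)
  have XL: "X m \<in> L" for m
  proof -
    obtain l where l: "(\<lambda>n. Z n \<bullet> X m) \<longlonglongrightarrow> l" using ex[of m] by (auto simp: Z_def)
    have "p \<bullet> X m = l"
    proof -
      have "\<bar>p \<bullet> X m - l\<bar> \<le> e" if "0 < e" for e
      proof -
        obtain N where N: "\<And>n. n \<ge> N \<Longrightarrow> \<bar>Z n \<bullet> X m - l\<bar> < e"
          using LIMSEQ_D[OF l \<open>0 < e\<close>] by auto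
        \<comment> \<open>A slab around the limit value: closed, convex and containing a tail of
          \<open>Z\<close>, hence also \<open>K N\<close> and \<open>p\<close>.\<close>
        let ?T = "{w. X m \<bullet> w \<le> l + e} \<inter> {w. X m \<bullet> w \<ge> l - e}"
        have "K N \<subseteq> ?T"
        proof (rule K_min)
          show "closed ?T" by (intro closed_Int closed_halfspace_le closed_halfspace_ge)
          show "convex ?T" by (intro convex_Int convex_halfspace_le convex_halfspace_ge)
          show "Z n \<in> ?T" if "N \<le> n" for n using N[OF that] by (auto simp: inner_commute)
        qed
        then have "p \<in> ?T" using p by blast
        then show ?thesis by (auto simp: inner_commute abs_le_iff)
      qed
      then show ?thesis by (metis abs_le_zero_iff dense_ge eq_iff_diff_eq_0)
    qed
    then show ?thesis using l unfolding L_def by (simp add: inner_diff_left LIM_zero)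
  qed
  have pL: "p \<in> L" using K_min[of L 0] clL subL XL p[of 0] by (auto simp: Z_def subspace_imp_convex)
  have "(\<lambda>n. Z n \<bullet> v) \<longlonglongrightarrow> p \<bullet> v" for v
  proof -
    \<comment> \<open>Testing against \<open>v\<close> reduces to testing against its projection
      \<open>w\<close>, because \<open>Z n - p\<close> lies in \<open>L\<close> and
      \<open>v - w\<close> is orthogonal to \<open>L\<close>.\<close>
    define w where "w = metric_proj L v"
    have "L \<noteq> {}" using pL by blast
    note w = metric_proj_closed_convex[OF clL subspace_imp_convex[OF subL] this, where a=v, folded w_def]
    have orth: "(v - w) \<bullet> l = 0" if "l \<in> L" for l
    proof -
      have "w + l \<in> L" "w - l \<in> L" using subL w(1) that by (auto intro: subspace_add subspace_diff)
      from w(2)[OF this(1)] w(2)[OF this(2)] show ?thesis by simp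
    qed
    have "(Z n - p) \<bullet> v = (Z n - p) \<bullet> w" for n
    proof -
      have "Z n - p \<in> L" using subL XL pL by (auto simp: Z_def intro: subspace_diff)
      from orth[OF this] show ?thesis by (simp add: inner_commute inner_diff_right)
    qed
    then have "(\<lambda>n. (Z n - p) \<bullet> v) \<longlonglongrightarrow> 0" using w(1) by (simp add: L_def)
    then show ?thesis by (simp add: inner_diff_left LIM_zero_iff)
  qed
  then show ?thesis using that r unfolding Z_def weakly_converges_def by blast
qed

text \<open>Demiclosedness principle. Expanding \<open>X n - S p\<close> around \<open>p\<close>
  gives the squared norm of \<open>p - S p\<close> and a cross term that vanishes by weak
  convergence. Nonexpansiveness bounds the norm of \<open>X n - S p\<close> by
  \<open>e n + norm (X n - p)\<close>, and the squares of \<open>norm (X n - p)\<close>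
  cancel.\<close>

lemma nonexpansive_demiclosed:
  fixes S :: "'a::real_inner \<Rightarrow> 'a"
  assumes S: "nonexpansive_on C S" and X: "\<And>n. X n \<in> C" and p: "p \<in> C"
    and lim: "weakly_converges X p" and bdd: "\<And>n. norm (X n) \<le> B"
    and res: "(\<lambda>n. X n - S (X n)) \<longlonglongrightarrow> 0"
  shows "S p = p"
proof -
  define e where "e n = norm (X n - S (X n))" for n
  have e0: "e \<longlonglongrightarrow> 0" unfolding e_def using res by (rule tendsto_norm_zero)
  have "(norm (p - S p))\<^sup>2 \<le> e n * (e n + 2 * (B + norm p)) - 2 * ((X n - p) \<bullet> (p - S p))" for n
  proof -
    have "norm (X n - S p) \<le> e n + norm (X n - p)"
      using S X[of n] p norm_triangle_ineq[of "X n - S (X n)" "S (X n) - S p"]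
      unfolding nonexpansive_on_def e_def by fastforce
    then have "(norm (X n - S p))\<^sup>2 \<le> (e n + norm (X n - p))\<^sup>2" by (simp add: power_mono)
    also have "\<dots> = e n * (e n + 2 * norm (X n - p)) + (norm (X n - p))\<^sup>2"
      by (simp add: power2_eq_square algebra_simps)
    also have "e n * (e n + 2 * norm (X n - p)) \<le> e n * (e n + 2 * (B + norm p))"
      using norm_triangle_ineq4[of "X n" p] bdd[of n]
      by (intro mult_left_mono) (auto simp: e_def)
    finally have "(norm (X n - S p))\<^sup>2 \<le> e n * (e n + 2 * (B + norm p)) + (norm (X n - p))\<^sup>2" by simp
    moreover have "(norm (X n - S p))\<^sup>2
        = (norm (X n - p))\<^sup>2 + 2 * ((X n - p) \<bullet> (p - S p)) + (norm (p - S p))\<^sup>2"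
      by (simp add: power2_norm_eq_inner inner_diff_left inner_diff_right inner_commute)
    ultimately show ?thesis by linarith
  qed
  moreover have "(\<lambda>n. e n * (e n + 2 * (B + norm p)) - 2 * ((X n - p) \<bullet> (p - S p))) \<longlonglongrightarrow> 0"
  proof -
    have "(\<lambda>n. (X n - p) \<bullet> (p - S p)) \<longlonglongrightarrow> 0"
      using lim unfolding weakly_converges_def inner_diff_left by (simp add: LIM_zero)
    then have "(\<lambda>n. e n * (e n + 2 * (B + norm p)) - 2 * ((X n - p) \<bullet> (p - S p)))
        \<longlonglongrightarrow> 0 * (0 + 2 * (B + norm p)) - 2 * 0"
      using e0 by (intro tendsto_intros)
    then show ?thesis by simp
  qed
  ultimately have "(norm (p - S p))\<^sup>2 \<le> 0" by (intro LIMSEQ_le_const) auto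
  then show ?thesis by simp
qed

lemma weakly_converges_add_null:
  fixes X Y :: "nat \<Rightarrow> 'a::real_inner"
  assumes "weakly_converges X p" "(\<lambda>n. X n - Y n) \<longlonglongrightarrow> 0"
  shows "weakly_converges Y p"
  unfolding weakly_converges_def
proof
  fix v
  have "(\<lambda>n. X n \<bullet> v) \<longlonglongrightarrow> p \<bullet> v" using assms(1) unfolding weakly_converges_def by blast
  from tendsto_diff[OF this tendsto_inner[OF assms(2) tendsto_const[of v]]]
  have "(\<lambda>n. X n \<bullet> v - (X n - Y n) \<bullet> v) \<longlonglongrightarrow> p \<bullet> v - 0 \<bullet> v" .
  then show "(\<lambda>n. Y n \<bullet> v) \<longlonglongrightarrow> p \<bullet> v" by (simp add: inner_diff_left)
qed

section \<open>Null sequences and squared-distance identities\<close>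

lemma null_if_scaled_norm_sq_le_null:
  fixes a :: "nat \<Rightarrow> 'a::real_normed_vector"
  assumes c: "0 < c" and le: "\<forall>\<^sub>F n in sequentially. c * (norm (a n))\<^sup>2 \<le> d n"
    and d: "d \<longlonglongrightarrow> 0"
  shows "a \<longlonglongrightarrow> 0"
proof -
  have "(\<lambda>n. (norm (a n))\<^sup>2) \<longlonglongrightarrow> 0"
  proof (rule tendsto_sandwich[of "\<lambda>_. 0"])
    show "\<forall>\<^sub>F n in sequentially. (norm (a n))\<^sup>2 \<le> d n / c"
      using le by eventually_elim (use c in \<open>simp add: field_simps\<close>)
    show "(\<lambda>n. d n / c) \<longlonglongrightarrow> 0" using tendsto_divide_zero[OF d] .
  qed auto
  then have "(\<lambda>n. sqrt ((norm (a n))\<^sup>2)) \<longlonglongrightarrow> sqrt 0" by (rule tendsto_real_sqrt)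
  then show ?thesis by (simp add: tendsto_norm_zero_iff)
qed

text \<open>The difference of squares factors into a part dominated by
  \<open>norm (a n - b n)\<close> and a part that stays bounded, since \<open>B\<close> also
  controls \<open>b n - p\<close> up to that same norm.\<close>

lemma norm_sq_diff_null:
  fixes a b :: "nat \<Rightarrow> 'a::real_normed_vector"
  assumes B: "\<And>n. norm (a n - p) \<le> B" and ab: "(\<lambda>n. a n - b n) \<longlonglongrightarrow> 0"
  shows "(\<lambda>n. (norm (a n - p))\<^sup>2 - (norm (b n - p))\<^sup>2) \<longlonglongrightarrow> 0"
proof (rule Lim_null_comparison)
  show "\<forall>\<^sub>F n in sequentially. norm ((norm (a n - p))\<^sup>2 - (norm (b n - p))\<^sup>2)
      \<le> norm (a n - b n) * (2 * B + norm (a n - b n))"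
  proof (intro always_eventually allI)
    fix n
    have "\<bar>norm (a n - p) - norm (b n - p)\<bar> \<le> norm (a n - b n)"
      using norm_triangle_ineq3[of "a n - p" "b n - p"] by simp
    moreover have "norm (a n - p) + norm (b n - p) \<le> 2 * B + norm (a n - b n)"
      using B[of n] calculation by linarith
    ultimately have "\<bar>norm (a n - p) - norm (b n - p)\<bar> * (norm (a n - p) + norm (b n - p))
        \<le> norm (a n - b n) * (2 * B + norm (a n - b n))"
      by (intro mult_mono) auto
    then show "norm ((norm (a n - p))\<^sup>2 - (norm (b n - p))\<^sup>2)
        \<le> norm (a n - b n) * (2 * B + norm (a n - b n))"
      by (simp add: power2_eq_square square_diff_square_factored abs_mult mult.commute)
  qed
  have "(\<lambda>n. norm (a n - b n) * (2 * B + norm (a n - b n))) \<longlonglongrightarrow> 0 * (2 * B + 0)"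
    using tendsto_norm_zero[OF ab] by (intro tendsto_intros)
  then show "(\<lambda>n. norm (a n - b n) * (2 * B + norm (a n - b n))) \<longlonglongrightarrow> 0" by simp
qed

text \<open>Parallel-axis identity: the difference of the squared distances to \<open>p\<close> and
  to \<open>u\<close> is affine in \<open>w l\<close>, so its weighted sum sees only the barycentre
  \<open>u\<close>.\<close>

lemma convex_combination_sq_dist:
  fixes w :: "'i \<Rightarrow> 'a::real_inner"
  assumes a: "(\<Sum>l\<in>I. a l) = 1" and u: "u = (\<Sum>l\<in>I. a l *\<^sub>R w l)"
  shows "(\<Sum>l\<in>I. a l * (norm (w l - p))\<^sup>2)
    = (norm (u - p))\<^sup>2 + (\<Sum>l\<in>I. a l * (norm (w l - u))\<^sup>2)"
proof -
  have "a l * (norm (w l - p))\<^sup>2 - a l * (norm (w l - u))\<^sup>2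
      = 2 * ((a l *\<^sub>R w l) \<bullet> (u - p)) + a l * ((norm p)\<^sup>2 - (norm u)\<^sup>2)" for l
    by (simp add: power2_norm_eq_inner inner_diff_left inner_diff_right inner_commute
        algebra_simps)
  then have "(\<Sum>l\<in>I. a l * (norm (w l - p))\<^sup>2) - (\<Sum>l\<in>I. a l * (norm (w l - u))\<^sup>2)
      = 2 * (u \<bullet> (u - p)) + ((norm p)\<^sup>2 - (norm u)\<^sup>2)"
    unfolding sum_subtractf[symmetric]
    by (simp add: sum.distrib sum_distrib_left[symmetric] sum_distrib_right[symmetric]
        inner_sum_left[symmetric] a u[symmetric] del: inner_scaleR_left)
  also have "\<dots> = (norm (u - p))\<^sup>2"
    by (simp add: power2_norm_eq_inner inner_diff_left inner_diff_right inner_commute)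
  finally show ?thesis by simp
qed

text \<open>Of the nonnegative variance terms only the one for \<open>j\<close> is kept; it later
  forces \<open>S j (zb n) - u n\<close> to vanish.\<close>

lemma mann_step_sq_dist:
  fixes w :: "nat \<Rightarrow> 'a::real_inner"
  assumes a: "(\<Sum>l=0..M. a l) = 1" "\<And>l. l \<in> {0..M} \<Longrightarrow> 0 \<le> a l"
    and u: "u = a 0 *\<^sub>R x + (\<Sum>l=1..M. a l *\<^sub>R w l)"
    and w: "\<And>l. l \<in> {1..M} \<Longrightarrow> norm (w l - p) \<le> norm (z - p)"
    and j: "j \<in> {1..M}"
  shows "(norm (u - p))\<^sup>2 + a j * (norm (w j - u))\<^sup>2
    \<le> a 0 * (norm (x - p))\<^sup>2 + (1 - a 0) * (norm (z - p))\<^sup>2"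
proof -
  define W where "W l = (if l = 0 then x else w l)" for l
  have split: "(\<Sum>l=0..M. g l) = g 0 + (\<Sum>l=1..M. g l)" for g :: "nat \<Rightarrow> 'b::comm_monoid_add"
    by (simp add: sum.atLeast_Suc_atMost)
  have "u = (\<Sum>l=0..M. a l *\<^sub>R W l)" unfolding u split by (simp add: W_def)
  note comb = convex_combination_sq_dist[OF a(1) this, of p]
  have "a j * (norm (w j - u))\<^sup>2 = a j * (norm (W j - u))\<^sup>2" using j by (simp add: W_def)
  also have "\<dots> \<le> (\<Sum>l=0..M. a l * (norm (W l - u))\<^sup>2)"
    using j a(2) by (intro member_le_sum) auto
  finally have "(norm (u - p))\<^sup>2 + a j * (norm (w j - u))\<^sup>2 \<le> (\<Sum>l=0..M. a l * (norm (W l - p))\<^sup>2)"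
    unfolding comb by simp
  also have "\<dots> = a 0 * (norm (x - p))\<^sup>2 + (\<Sum>l=1..M. a l * (norm (w l - p))\<^sup>2)"
    unfolding split by (simp add: W_def)
  also have "(\<Sum>l=1..M. a l * (norm (w l - p))\<^sup>2) \<le> (\<Sum>l=1..M. a l * (norm (z - p))\<^sup>2)"
    using a(2) w by (intro sum_mono mult_left_mono power_mono) auto
  also have "\<dots> = (1 - a 0) * (norm (z - p))\<^sup>2"
    using a(1) unfolding split by (simp add: sum_distrib_right[symmetric])
  finally show ?thesis by simp
qed

section \<open>The projection scheme with half-space cuts\<close>

text \<open>Separates the geometry of the cuts from the construction of \<open>u n\<close>, which
  enters only through \<open>fejer\<close>. That estimate is conditional on
  \<open>x n \<in> C\<close> because the membership is itself obtained in the induction of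
  \<open>iterate_invariant\<close>.\<close>

locale hybrid_projection =
  fixes C F :: "'a::{real_inner,complete_space} set" and x u :: "nat \<Rightarrow> 'a"
  assumes closed_C: "closed C" and convex_C: "convex C"
    and F_subset: "F \<subseteq> C" and F_nonempty: "F \<noteq> {}"
    and start: "x 0 \<in> C"
    and step: "\<And>n. x (Suc n) = metric_proj ({v \<in> C. norm (u n - v) \<le> norm (x n - v)} \<inter>
      {v \<in> C. (x 0 - x n) \<bullet> (v - x n) \<le> 0}) (x 0)"
    and fejer: "\<And>n p. x n \<in> C \<Longrightarrow> p \<in> F \<Longrightarrow> norm (u n - p) \<le> norm (x n - p)"
begin

text \<open>The set \<open>C_n \<inter> Q_n\<close> of the method.\<close>

definition halfspace_cut :: "nat \<Rightarrow> 'a set" where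
  "halfspace_cut n = {v \<in> C. norm (u n - v) \<le> norm (x n - v)} \<inter>
      {v \<in> C. (x 0 - x n) \<bullet> (v - x n) \<le> 0}"

lemma closed_halfspace_cut: "closed (halfspace_cut n)"
proof -
  have "halfspace_cut n = C \<inter> {v. norm (u n - v) \<le> norm (x n - v)} \<inter>
      {v. (x 0 - x n) \<bullet> (v - x n) \<le> 0}"
    by (auto simp: halfspace_cut_def)
  then show ?thesis
    using closed_C by (auto intro!: closed_Int closed_Collect_le continuous_intros)
qed

lemma convex_halfspace_cut: "convex (halfspace_cut n)"
proof -
  \<comment> \<open>After squaring, \<open>v \<bullet> v\<close> cancels and the condition becomes
    affine in \<open>v\<close>.\<close>
  have "norm (u n - v) \<le> norm (x n - v)
      \<longleftrightarrow> (2 *\<^sub>R (x n - u n)) \<bullet> v \<le> (norm (x n))\<^sup>2 - (norm (u n))\<^sup>2" for v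
    unfolding norm_le power2_norm_eq_inner
    by (simp add: inner_diff_left inner_diff_right inner_commute algebra_simps)
  then have "halfspace_cut n = C \<inter> {v. (2 *\<^sub>R (x n - u n)) \<bullet> v \<le> (norm (x n))\<^sup>2 - (norm (u n))\<^sup>2}
      \<inter> {v. (x 0 - x n) \<bullet> v \<le> (x 0 - x n) \<bullet> x n}"
    by (auto simp: halfspace_cut_def inner_diff_right)
  then show ?thesis using convex_C by (simp only:) (intro convex_Int convex_halfspace_le)
qed

text \<open>The two claims feed each other: a nonempty \<open>F\<close> inside the cut makes the
  next projection exist, and the obtuse-angle inequality of that projection puts \<open>F\<close>
  into the next cut.\<close>

lemma iterate_invariant: "x n \<in> C \<and> F \<subseteq> halfspace_cut n"
proof (induction n)
  case 0
  then show ?case using start F_subset fejer[OF start] by (auto simp: halfspace_cut_def)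
next
  case (Suc n)
  then have "halfspace_cut n \<noteq> {}" using F_nonempty by blast
  note proj = metric_proj_closed_convex[OF closed_halfspace_cut convex_halfspace_cut this, where a="x 0"]
  have x: "x (Suc n) = metric_proj (halfspace_cut n) (x 0)" unfolding halfspace_cut_def by (rule step)
  have xC: "x (Suc n) \<in> C" using proj(1) unfolding x by (auto simp: halfspace_cut_def)
  have "(x 0 - x (Suc n)) \<bullet> (v - x (Suc n)) \<le> 0" if "v \<in> F" for v
    using proj(2)[of v] that Suc unfolding x by blast
  then show ?case using xC fejer[OF xC] F_subset by (auto simp: halfspace_cut_def)
qed

lemma iterate_in: "x n \<in> C" using iterate_invariant by blast

lemma next_in_cut: "x (Suc n) \<in> halfspace_cut n"
proof -
  have "halfspace_cut n \<noteq> {}" using F_nonempty iterate_invariant by blast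
  from metric_proj_closed_convex(1)[OF closed_halfspace_cut convex_halfspace_cut this, where a="x 0"]
  show ?thesis using step[of n] by (simp add: halfspace_cut_def)
qed

text \<open>Law of cosines at \<open>x n\<close>; membership in the cut fixes the sign of the cross
  term.\<close>

lemma cut_sq_dist:
  assumes "v \<in> halfspace_cut n"
  shows "(norm (v - x n))\<^sup>2 \<le> (norm (v - x 0))\<^sup>2 - (norm (x n - x 0))\<^sup>2"
proof -
  have "(norm (v - x 0))\<^sup>2 = (norm (v - x n))\<^sup>2 + (norm (x n - x 0))\<^sup>2 - 2 * ((x 0 - x n) \<bullet> (v - x n))"
    by (simp add: power2_norm_eq_inner inner_diff_left inner_diff_right inner_commute)
  then show ?thesis using assms by (simp add: halfspace_cut_def)
qed

lemma dist_le_of_cut: "v \<in> halfspace_cut n \<Longrightarrow> norm (x n - x 0) \<le> norm (v - x 0)"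
  using cut_sq_dist[of v n] zero_le_power2[of "norm (v - x n)"]
  by (intro power2_le_imp_le[OF _ norm_ge_zero]) linarith

lemma incseq_dist: "incseq (\<lambda>n. norm (x n - x 0))"
  by (intro incseq_SucI dist_le_of_cut next_in_cut)

lemma dist_le: "q \<in> F \<Longrightarrow> norm (x n - x 0) \<le> norm (q - x 0)"
  using iterate_invariant dist_le_of_cut by blast

lemma dist_convergent:
  obtains D where "(\<lambda>n. norm (x n - x 0)) \<longlonglongrightarrow> D" "\<And>n. norm (x n - x 0) \<le> D"
    "\<And>q. q \<in> F \<Longrightarrow> D \<le> norm (q - x 0)"
proof -
  obtain q where q: "q \<in> F" using F_nonempty by blast
  obtain D where D: "(\<lambda>n. norm (x n - x 0)) \<longlonglongrightarrow> D" "\<And>n. norm (x n - x 0) \<le> D"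
    using incseq_convergent[OF incseq_dist] dist_le[OF q] by blast
  have "D \<le> norm (q - x 0)" if "q \<in> F" for q
    using dist_le[OF that] by (intro LIMSEQ_le_const2[OF D(1)]) blast
  with D that show ?thesis by blast
qed

text \<open>The squared steps are bounded by consecutive differences of a convergent sequence of
  squared distances.\<close>

lemma successive_null: "(\<lambda>n. x (Suc n) - x n) \<longlonglongrightarrow> 0"
proof -
  obtain D where D: "(\<lambda>n. norm (x n - x 0)) \<longlonglongrightarrow> D" by (rule dist_convergent)
  have "(\<lambda>n. (norm (x (Suc n) - x 0))\<^sup>2 - (norm (x n - x 0))\<^sup>2) \<longlonglongrightarrow> D\<^sup>2 - D\<^sup>2"
    using D LIMSEQ_Suc[OF D] by (intro tendsto_intros)
  then have lim: "(\<lambda>n. (norm (x (Suc n) - x 0))\<^sup>2 - (norm (x n - x 0))\<^sup>2) \<longlonglongrightarrow> 0" by simp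
  show ?thesis
    by (rule null_if_scaled_norm_sq_le_null[OF zero_less_one _ lim])
      (simp add: cut_sq_dist[OF next_in_cut])
qed

text \<open>\<open>x (Suc n)\<close> lies in the cut, hence no farther from \<open>u n\<close> than
  from \<open>x n\<close>; the triangle inequality gives the factor 2.\<close>

lemma residual_null: "(\<lambda>n. x n - u n) \<longlonglongrightarrow> 0"
proof (rule Lim_null_comparison)
  show "\<forall>\<^sub>F n in sequentially. norm (x n - u n) \<le> 2 * norm (x (Suc n) - x n)"
  proof (intro always_eventually allI)
    fix n
    have "norm (u n - x (Suc n)) \<le> norm (x n - x (Suc n))"
      using next_in_cut[of n] by (simp add: halfspace_cut_def)
    then show "norm (x n - u n) \<le> 2 * norm (x (Suc n) - x n)"
      using norm_triangle_ineq[of "x n - x (Suc n)" "x (Suc n) - u n"]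
      by (simp add: norm_minus_commute)
  qed
  show "(\<lambda>n. 2 * norm (x (Suc n) - x n)) \<longlonglongrightarrow> 0"
    using successive_null by (intro tendsto_mult_right_zero tendsto_norm_zero)
qed

text \<open>Every nearest point \<open>q\<close> of \<open>F\<close> lies in the half-space cut at \<open>x n\<close>, so its distance to
  \<open>x n\<close> is controlled by the gap between the distances to \<open>x 0\<close>. A single weak
  cluster point in \<open>F\<close> shows that this gap tends to \<open>0\<close>.\<close>

lemma converges_to_projection:
  assumes cluster: "\<And>r p. strict_mono r \<Longrightarrow> weakly_converges (x \<circ> r) p \<Longrightarrow> p \<in> F"
  shows "x \<longlonglongrightarrow> metric_proj F (x 0)"
proof -
  obtain D where D: "(\<lambda>n. norm (x n - x 0)) \<longlonglongrightarrow> D" "\<And>n. norm (x n - x 0) \<le> D"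
    "\<And>q. q \<in> F \<Longrightarrow> D \<le> norm (q - x 0)" using dist_convergent by blast
  have "norm (x n) \<le> D + norm (x 0)" for n
    using D(2)[of n] norm_triangle_sub[of "x n" "x 0"] by linarith
  then obtain r p where r: "strict_mono r" "weakly_converges (x \<circ> r) p"
    using bounded_weakly_convergent_subsequence by blast
  have p: "p \<in> F" using cluster[OF r] .
  \<comment> \<open>Weak lower semicontinuity of the norm, in the form that the closed ball of
    radius \<open>D\<close> contains the weak limit.\<close>
  have pD: "dist (x 0) p \<le> D"
    using weakly_converges_closed_convex[OF closed_cball convex_cball _ r(2), of "x 0" D] D(2)
    by (simp add: dist_norm norm_minus_commute[of "x 0"])
  have p_min: "dist (x 0) p \<le> dist (x 0) v" if "v \<in> F" for v
    using pD D(3)[OF that] by (simp add: dist_norm norm_minus_commute)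
  \<comment> \<open>The chosen minimiser \<open>q\<close> is not assumed to equal \<open>p\<close>;
    both bounds on its distance from \<open>x 0\<close> meet at \<open>D\<close>, which is all that
    follows uses.\<close>
  define q where "q = metric_proj F (x 0)"
  have q: "q \<in> F" "dist (x 0) q \<le> dist (x 0) p"
    using metric_proj_minimises[OF p p_min] p unfolding q_def by auto
  have "norm (q - x 0) = D"
    using q(2) pD D(3)[OF q(1)] by (simp add: dist_norm norm_minus_commute)
  then have le: "(norm (q - x n))\<^sup>2 \<le> D\<^sup>2 - (norm (x n - x 0))\<^sup>2" for n
    using cut_sq_dist[of q n] q(1) iterate_invariant[of n] by auto
  have "(\<lambda>n. D\<^sup>2 - (norm (x n - x 0))\<^sup>2) \<longlonglongrightarrow> D\<^sup>2 - D\<^sup>2"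
    using D(1) by (intro tendsto_intros)
  then have lim: "(\<lambda>n. D\<^sup>2 - (norm (x n - x 0))\<^sup>2) \<longlonglongrightarrow> 0" by simp
  have "(\<lambda>n. q - x n) \<longlonglongrightarrow> 0"
    by (rule null_if_scaled_norm_sq_le_null[OF zero_less_one _ lim]) (simp add: le)
  then have "(\<lambda>n. q - (q - x n)) \<longlonglongrightarrow> q - 0" by (intro tendsto_intros)
  then show ?thesis by (simp add: q_def)
qed

end

section \<open>Proximal steps and the extragradient estimate\<close>

text \<open>Quadratic growth from strong convexity: minimality is compared at
  \<open>s *\<^sub>R y + (1 - s) *\<^sub>R v\<close>, the common factor \<open>1 - s\<close> is
  cancelled, and \<open>s\<close> tends to 1.\<close>

lemma prox_strong_inequality:
  fixes \<phi> :: "'a::real_inner \<Rightarrow> real"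
  assumes \<phi>: "convex_on C \<phi>" and y: "y \<in> C"
    and min: "\<And>v. v \<in> C \<Longrightarrow> \<phi> y + 1/2 * (norm (x - y))\<^sup>2 \<le> \<phi> v + 1/2 * (norm (x - v))\<^sup>2"
    and v: "v \<in> C"
  shows "\<phi> y + 1/2 * (norm (x - y))\<^sup>2 + 1/2 * (norm (v - y))\<^sup>2 \<le> \<phi> v + 1/2 * (norm (x - v))\<^sup>2"
proof -
  have "s * (1/2 * (norm (v - y))\<^sup>2)
      \<le> \<phi> v + 1/2 * (norm (x - v))\<^sup>2 - (\<phi> y + 1/2 * (norm (x - y))\<^sup>2)"
    if s: "0 < s" "s < 1" for s
  proof -
    define w where "w = s *\<^sub>R y + (1 - s) *\<^sub>R v"
    have "convex C" using \<phi> unfolding convex_on_def by blast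
    then have w: "w \<in> C" using y v s unfolding w_def by (intro convexD) auto
    have "\<phi> w \<le> s * \<phi> y + (1 - s) * \<phi> v"
      using \<phi> y v s unfolding w_def convex_on_def by simp
    moreover have "(norm (x - w))\<^sup>2
        = s * (norm (x - y))\<^sup>2 + (1 - s) * (norm (x - v))\<^sup>2 - s * (1 - s) * (norm (v - y))\<^sup>2"
    proof -
      define a b where "a = x - y" and "b = x - v"
      have eqs: "x - w = s *\<^sub>R a + (1 - s) *\<^sub>R b" "v - y = a - b"
        by (simp_all add: w_def a_def b_def algebra_simps)
      show ?thesis unfolding eqs a_def[symmetric] b_def[symmetric]
        by (simp add: power2_norm_eq_inner inner_simps inner_commute[of b a] algebra_simps)
    qed
    ultimately have "(1 - s) * (s * (1/2 * (norm (v - y))\<^sup>2))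
        \<le> (1 - s) * (\<phi> v + 1/2 * (norm (x - v))\<^sup>2 - (\<phi> y + 1/2 * (norm (x - y))\<^sup>2))"
      using min[OF w] by (simp add: algebra_simps diff_divide_distrib)
    then show ?thesis using s by simp
  qed
  then have "1/2 * (norm (v - y))\<^sup>2
      \<le> \<phi> v + 1/2 * (norm (x - v))\<^sup>2 - (\<phi> y + 1/2 * (norm (x - y))\<^sup>2)"
    by (rule field_le_mult_one_interval)
  then show ?thesis by simp
qed

text \<open>The value \<open>\<infinity>\<close> is excluded because the subgradient inequality is tested at the zero
  \<open>v\<close> of \<open>f v\<close>.\<close>

lemma subdifferentiable_bifunction_finite:
  assumes f: "bifunction_on C f" and sub: "subdifferentiable_on C (f v)"
    and v: "v \<in> C" and w: "w \<in> C"
  shows "f v w = ereal (real_of_ereal (f v w))"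
proof -
  obtain \<xi> where "\<xi> \<in> subdifferential C (f v) w"
    using sub w unfolding subdifferentiable_on_def by blast
  then have "f v w + ereal (\<xi> \<bullet> (v - w)) \<le> f v v" using v unfolding subdifferential_def by blast
  then have "f v w \<noteq> \<infinity>" using f v unfolding bifunction_on_def by auto
  moreover have "f v w \<noteq> - \<infinity>" using f v w unfolding bifunction_on_def by blast
  ultimately show ?thesis by (cases "f v w") auto
qed

lemma prox_argmin_inequality:
  fixes g :: "'a::real_inner \<Rightarrow> ereal"
  assumes g: "ereal_convex_on C g" and fin: "\<And>v. v \<in> C \<Longrightarrow> g v = ereal (h v)"
    and \<rho>: "0 < \<rho>"
    and y: "is_arg_min (\<lambda>v. ereal \<rho> * g v + ereal (1/2 * (norm (x - v))\<^sup>2)) (\<lambda>v. v \<in> C) y"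
    and v: "v \<in> C"
  shows "\<rho> * h y + 1/2 * (norm (x - y))\<^sup>2 + 1/2 * (norm (v - y))\<^sup>2 \<le> \<rho> * h v + 1/2 * (norm (x - v))\<^sup>2"
proof (rule prox_strong_inequality[OF _ _ _ v])
  show yC: "y \<in> C" using y unfolding is_arg_min_def by blast
  have C: "convex C" using g unfolding ereal_convex_on_def by blast
  have "h (s *\<^sub>R a + t *\<^sub>R b) \<le> s * h a + t * h b"
    if "a \<in> C" "b \<in> C" "0 \<le> s" "0 \<le> t" "s + t = 1" for a b s t
  proof -
    have "s *\<^sub>R a + t *\<^sub>R b \<in> C" using C that by (simp add: convexD)
    moreover have "g (s *\<^sub>R a + t *\<^sub>R b) \<le> ereal s * g a + ereal t * g b"
      using g that unfolding ereal_convex_on_def by blast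
    ultimately show ?thesis using that by (simp add: fin)
  qed
  then have "convex_on C h" using C unfolding convex_on_def by blast
  then show "convex_on C (\<lambda>v. \<rho> * h v)" using \<rho> by (simp add: convex_on_cmul)
  show "\<rho> * h y + 1/2 * (norm (x - y))\<^sup>2 \<le> \<rho> * h v + 1/2 * (norm (x - v))\<^sup>2" if "v \<in> C" for v
    using y that yC unfolding is_arg_min_linorder by (auto simp: fin)
qed

text \<open>Add the proximal inequality for \<open>y\<close> tested at \<open>z\<close> to that for
  \<open>z\<close> tested at \<open>p\<close>. The squares of \<open>x - z\<close> cancel, the
  Lipschitz-type condition absorbs the values at \<open>(x, z)\<close>, \<open>(x, y)\<close> and
  \<open>(y, z)\<close>, and pseudomonotonicity makes the value at \<open>(y, p)\<close>
  nonpositive.\<close>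

lemma extragradient_sq_dist:
  fixes f :: "'a::real_inner \<Rightarrow> 'a \<Rightarrow> ereal"
  assumes f: "bifunction_on C f" "pseudomonotone_on C f" "lipschitz_type_on c1 c2 C f"
    and cvx: "\<And>v. v \<in> C \<Longrightarrow> ereal_convex_on C (f v)"
    and sub: "\<And>v. v \<in> C \<Longrightarrow> subdifferentiable_on C (f v)"
    and \<rho>: "0 < \<rho>" and x: "x \<in> C" and p: "p \<in> EP C f"
    and y: "is_arg_min (\<lambda>v. ereal \<rho> * f x v + ereal (1/2 * (norm (x - v))\<^sup>2)) (\<lambda>v. v \<in> C) y"
    and z: "is_arg_min (\<lambda>v. ereal \<rho> * f y v + ereal (1/2 * (norm (x - v))\<^sup>2)) (\<lambda>v. v \<in> C) z"
  shows "(norm (z - p))\<^sup>2 \<le> (norm (x - p))\<^sup>2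
    - (1 - 2 * \<rho> * c1) * (norm (x - y))\<^sup>2 - (1 - 2 * \<rho> * c2) * (norm (y - z))\<^sup>2"
proof -
  define h where "h v w = real_of_ereal (f v w)" for v w
  have fin: "f v w = ereal (h v w)" if "v \<in> C" "w \<in> C" for v w
    unfolding h_def using subdifferentiable_bifunction_finite[OF f(1) sub[OF that(1)] that] .
  have yC: "y \<in> C" and zC: "z \<in> C" using y z unfolding is_arg_min_def by auto
  have pC: "p \<in> C" and "f p y \<ge> 0" using p yC unfolding EP_def by auto
  then have "f y p \<le> 0" using f(2) yC unfolding pseudomonotone_on_def by blast
  then have hyp: "\<rho> * h y p \<le> 0" using fin[OF yC pC] \<rho> by (simp add: mult_nonneg_nonpos)
  have "h x z - c1 * (norm (x - y))\<^sup>2 - c2 * (norm (y - z))\<^sup>2 \<le> h x y + h y z"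
    using f(3) x yC zC unfolding lipschitz_type_on_def by (force simp: fin)
  from mult_left_mono[OF this less_imp_le[OF \<rho>]]
  have lip: "\<rho> * h x z - \<rho> * c1 * (norm (x - y))\<^sup>2 - \<rho> * c2 * (norm (y - z))\<^sup>2
      \<le> \<rho> * h x y + \<rho> * h y z"
    by (simp add: algebra_simps)
  show ?thesis
    using prox_argmin_inequality[OF cvx[OF x] fin[OF x] \<rho> y zC]
      prox_argmin_inequality[OF cvx[OF yC] fin[OF yC] \<rho> z pC] lip hyp
    by (simp add: norm_minus_commute algebra_simps)
qed

section \<open>Convergence of the parallel hybrid extragradient iteration\<close>

theorem theorem3:
  fixes C F :: "'a::{real_inner,complete_space} set"
    and N M :: nat
    and f :: "nat \<Rightarrow> 'a \<Rightarrow> 'a \<Rightarrow> ereal"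
    and S :: "nat \<Rightarrow> 'a \<Rightarrow> 'a"
    and c1 c2 \<rho> :: real
    and \<alpha> :: "nat \<Rightarrow> nat \<Rightarrow> real"
    and x0 :: 'a
    and x u :: "nat \<Rightarrow> 'a"
    and y z :: "nat \<Rightarrow> nat \<Rightarrow> 'a"
    and i :: "nat \<Rightarrow> nat"
  assumes "C \<noteq> {}" and "closed C" and "convex C"
    and "N \<ge> 1" and "M \<ge> 1"
    and "\<And>k. k \<in> {1..N} \<Longrightarrow> bifunction_on C (f k)"
    and "\<And>k. k \<in> {1..N} \<Longrightarrow> pseudomonotone_on C (f k)"
    and "c1 > 0" and "c2 > 0"
    and "\<And>k. k \<in> {1..N} \<Longrightarrow> lipschitz_type_on c1 c2 C (f k)"
    and "\<And>k. k \<in> {1..N} \<Longrightarrow> weakly_continuous_on C (f k)"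
    and "\<And>k v. k \<in> {1..N} \<Longrightarrow> v \<in> C \<Longrightarrow> ereal_convex_on C (f k v)"
    and "\<And>k v. k \<in> {1..N} \<Longrightarrow> v \<in> C \<Longrightarrow> subdifferentiable_on C (f k v)"
    and "\<And>j. j \<in> {1..M} \<Longrightarrow> S j \<in> C \<rightarrow> C"
    and "\<And>j. j \<in> {1..M} \<Longrightarrow> nonexpansive_on C (S j)"
    and "F = (\<Inter>k\<in>{1..N}. EP C (f k)) \<inter> (\<Inter>j\<in>{1..M}. fixed_points C (S j))"
    and "F \<noteq> {}"
    and "x0 \<in> C"
    and "0 < \<rho>" and "\<rho> < min (1 / (2 * c1)) (1 / (2 * c2))"
    and "\<And>n l. l \<in> {0..M} \<Longrightarrow> 0 < \<alpha> n l \<and> \<alpha> n l \<le> 1"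
    and "\<And>n. (\<Sum>l=0..M. \<alpha> n l) = 1"
    and "\<And>l. l \<in> {1..M} \<Longrightarrow> liminf (\<lambda>n. ereal (\<alpha> n 0 * \<alpha> n l)) > 0"
    and "parallel_hybrid_extragradient C N M f S \<rho> \<alpha> x0 x y z i u"
    and "\<And>n. x (Suc n) \<noteq> x n"
  shows "x \<longlonglongrightarrow> metric_proj F x0"
proof -
  note C = assms(2,3) and bif = assms(6) and pseudo = assms(7) and lip = assms(10)
    and wcont = assms(11) and cvx = assms(12) and sub = assms(13) and nonexp = assms(15)
    and F_eq = assms(16) and \<alpha> = assms(21,22) and \<rho> = assms(19)
  note alg = assms(24)[unfolded parallel_hybrid_extragradient_def]
  have x_0: "x 0 = x0" using alg by blast
  have y: "is_arg_min (\<lambda>v. ereal \<rho> * f k (x n) v + ereal (1/2 * (norm (x n - v))\<^sup>2)) (\<lambda>v. v \<in> C) (y n k)"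
    and z: "is_arg_min (\<lambda>v. ereal \<rho> * f k (y n k) v + ereal (1/2 * (norm (x n - v))\<^sup>2)) (\<lambda>v. v \<in> C) (z n k)"
    if "k \<in> {1..N}" for n k
    using alg that by blast+
  have i: "i n \<in> {1..N}" and far: "k \<in> {1..N} \<Longrightarrow> norm (z n k - x n) \<le> norm (z n (i n) - x n)" for n k
    using alg unfolding is_arg_max_linorder by blast+
  define zb where "zb n = z n (i n)" for n
  have u: "u n = \<alpha> n 0 *\<^sub>R x n + (\<Sum>j=1..M. \<alpha> n j *\<^sub>R S j (zb n))" for n
    using alg unfolding zb_def by blast
  have x_Suc: "x (Suc n) = metric_proj ({v \<in> C. norm (u n - v) \<le> norm (x n - v)} \<inter>
      {v \<in> C. (x 0 - x n) \<bullet> (v - x n) \<le> 0}) (x 0)" for n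
    using alg by blast
  have one: "1 \<in> {1..M}" "1 \<in> {1..N}" using assms(4,5) by auto
  have F_EP: "p \<in> EP C (f k)" if "p \<in> F" "k \<in> {1..N}" for p k
    using that unfolding F_eq by blast
  have F_fix: "p \<in> C \<and> S j p = p" if "p \<in> F" "j \<in> {1..M}" for p j
    using that unfolding F_eq fixed_points_def by blast
  have FC: "F \<subseteq> C" using F_fix one by blast
  have yC: "y n k \<in> C" and zC: "z n k \<in> C" if "k \<in> {1..N}" for n k
    using y[OF that] z[OF that] unfolding is_arg_min_def by blast+
  have zbC: "zb n \<in> C" for n unfolding zb_def using zC[OF i] .
  \<comment> \<open>One lower bound for both slack coefficients of the extragradient estimate; the
    upper bound on \<open>\<rho>\<close> makes it positive.\<close>
  define \<delta> where "\<delta> = min (1 - 2 * \<rho> * c1) (1 - 2 * \<rho> * c2)"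
  have \<delta>: "0 < \<delta>" using assms(8,9,20) by (simp add: \<delta>_def field_simps)
  have key: "\<delta> * (norm (x n - y n k))\<^sup>2 + \<delta> * (norm (y n k - z n k))\<^sup>2
      \<le> (norm (x n - p))\<^sup>2 - (norm (z n k - p))\<^sup>2"
    if "x n \<in> C" "p \<in> F" "k \<in> {1..N}" for n k p
  proof -
    have "\<delta> * (norm (x n - y n k))\<^sup>2 \<le> (1 - 2 * \<rho> * c1) * (norm (x n - y n k))\<^sup>2"
      "\<delta> * (norm (y n k - z n k))\<^sup>2 \<le> (1 - 2 * \<rho> * c2) * (norm (y n k - z n k))\<^sup>2"
      by (intro mult_right_mono; simp add: \<delta>_def)+
    then show ?thesis
      using extragradient_sq_dist[OF bif[OF that(3)] pseudo[OF that(3)] lip[OF that(3)]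
          cvx[OF that(3)] sub[OF that(3)] \<rho> that(1) F_EP[OF that(2,3)] y[OF that(3)] z[OF that(3)]]
      by linarith
  qed
  have zb_le: "(norm (zb n - p))\<^sup>2 \<le> (norm (x n - p))\<^sup>2" if "x n \<in> C" "p \<in> F" for n p
  proof -
    have "0 \<le> \<delta> * (norm (x n - y n (i n)))\<^sup>2 + \<delta> * (norm (y n (i n) - z n (i n)))\<^sup>2"
      using \<delta> by simp
    then show ?thesis using key[OF that i[of n]] unfolding zb_def by linarith
  qed
  have S_le: "norm (S j a - S j b) \<le> norm (a - b)" if "j \<in> {1..M}" "a \<in> C" "b \<in> C" for j a b
    using nonexp[OF that(1)] that unfolding nonexpansive_on_def by blast
  have mann: "(norm (u n - p))\<^sup>2 + \<alpha> n j * (norm (S j (zb n) - u n))\<^sup>2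
      \<le> \<alpha> n 0 * (norm (x n - p))\<^sup>2 + (1 - \<alpha> n 0) * (norm (zb n - p))\<^sup>2"
    if "p \<in> F" "j \<in> {1..M}" for n p j
  proof (rule mann_step_sq_dist[OF \<alpha>(2) _ u _ that(2)])
    show "0 \<le> \<alpha> n l" if "l \<in> {0..M}" for l using \<alpha>(1)[OF that, of n] by simp
    show "norm (S l (zb n) - p) \<le> norm (zb n - p)" if "l \<in> {1..M}" for l
      using S_le[OF that zbC[of n], of p] F_fix[OF \<open>p \<in> F\<close> that] by simp
  qed
  have \<alpha>0: "0 < \<alpha> n 0" "\<alpha> n 0 \<le> 1" for n using \<alpha>(1)[of 0 n] by auto
  \<comment> \<open>Rearranges \<open>mann\<close> so that the averaging loss and the extragradient
    loss are jointly controlled by the decrease from \<open>x n\<close> to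
    \<open>u n\<close>.\<close>
  have decrease: "\<alpha> n j * (norm (S j (zb n) - u n))\<^sup>2
      + (1 - \<alpha> n 0) * ((norm (x n - p))\<^sup>2 - (norm (zb n - p))\<^sup>2)
      \<le> (norm (x n - p))\<^sup>2 - (norm (u n - p))\<^sup>2" if "p \<in> F" "j \<in> {1..M}" for n p j
    using mann[OF that, of n] by (simp add: algebra_simps)

  interpret hybrid_projection C F x u
  proof
    show "x 0 \<in> C" using x_0 assms(18) by simp
    show "norm (u n - p) \<le> norm (x n - p)" if "x n \<in> C" "p \<in> F" for n p
    proof -
      have "0 \<le> \<alpha> n 1 * (norm (S 1 (zb n) - u n))\<^sup>2" using \<alpha>(1)[of 1 n] one by simp
      moreover have "0 \<le> (1 - \<alpha> n 0) * ((norm (x n - p))\<^sup>2 - (norm (zb n - p))\<^sup>2)"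
        using zb_le[OF that] \<alpha>0[of n] by simp
      ultimately have "(norm (u n - p))\<^sup>2 \<le> (norm (x n - p))\<^sup>2"
        using decrease[OF that(2) one(1), of n] by linarith
      then show ?thesis by (rule power2_le_imp_le) simp
    qed
  qed (use C FC assms(17) x_Suc in auto)

  obtain p0 where p0: "p0 \<in> F" using assms(17) by blast
  define B0 where "B0 = norm (p0 - x 0)"
  have bdd: "norm (x n - q) \<le> B0 + norm (x 0 - q)" for n q
    using norm_triangle_ineq[of "x n - x 0" "x 0 - q"] dist_le[OF p0, of n] by (simp add: B0_def)
  \<comment> \<open>\<open>d\<close> dominates all losses at \<open>p0\<close> and is null because
    \<open>x n - u n\<close> is.\<close>
  define d where "d n = (norm (x n - p0))\<^sup>2 - (norm (u n - p0))\<^sup>2" for n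
  have d0: "d \<longlonglongrightarrow> 0"
    unfolding d_def by (rule norm_sq_diff_null[OF bdd residual_null])
  \<comment> \<open>Since \<open>\<alpha> n 0 \<le> 1\<close>, an eventual lower bound on the
    product is one on \<open>\<alpha> n j\<close>.\<close>
  have lower: "\<exists>c>0. \<forall>\<^sub>F n in sequentially. c \<le> \<alpha> n j" if j: "j \<in> {1..M}" for j
  proof -
    obtain c where c: "0 < ereal c" "ereal c < liminf (\<lambda>n. ereal (\<alpha> n 0 * \<alpha> n j))"
      using ereal_dense2[OF assms(23)[OF j]] by blast
    have "\<forall>\<^sub>F n in sequentially. c \<le> \<alpha> n j"
      using less_LiminfD[OF c(2)]
    proof eventually_elim
      case (elim n)
      have "0 < \<alpha> n j" using \<alpha>(1)[of j n] j by simp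
      then have "\<alpha> n 0 * \<alpha> n j \<le> \<alpha> n j" using \<alpha>0[of n] by (simp add: mult_left_le_one_le)
      then show ?case using elim by simp
    qed
    then show ?thesis using c(1) by auto
  qed
  have gap: "0 \<le> (1 - \<alpha> n 0) * ((norm (x n - p0))\<^sup>2 - (norm (zb n - p0))\<^sup>2)" for n
    using zb_le[OF iterate_in p0] \<alpha>0[of n] by simp
  have S_null: "(\<lambda>n. S j (zb n) - u n) \<longlonglongrightarrow> 0" if j: "j \<in> {1..M}" for j
  proof -
    obtain c where c: "0 < c" "\<forall>\<^sub>F n in sequentially. c \<le> \<alpha> n j" using lower[OF j] by blast
    have "\<forall>\<^sub>F n in sequentially. c * (norm (S j (zb n) - u n))\<^sup>2 \<le> d n"
      using c(2)
    proof eventually_elim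
      case (elim n)
      then have "c * (norm (S j (zb n) - u n))\<^sup>2 \<le> \<alpha> n j * (norm (S j (zb n) - u n))\<^sup>2"
        by (rule mult_right_mono) simp
      then show ?case using decrease[OF p0 j, of n] gap[of n] unfolding d_def by linarith
    qed
    then show ?thesis by (rule null_if_scaled_norm_sq_le_null[OF c(1) _ d0])
  qed
  have zb_null: "(\<lambda>n. zb n - x n) \<longlonglongrightarrow> 0"
  proof -
    obtain c where c: "0 < c" "\<forall>\<^sub>F n in sequentially. c \<le> \<alpha> n 1" using lower[OF one(1)] by blast
    have "\<forall>\<^sub>F n in sequentially. c * \<delta> * (norm (x n - y n (i n)))\<^sup>2 \<le> d n
        \<and> c * \<delta> * (norm (y n (i n) - zb n))\<^sup>2 \<le> d n"
      using c(2)
    proof eventually_elim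
      case (elim n)
      \<comment> \<open>The weights sum to 1, so \<open>1 - \<alpha> n 0\<close> is at least
        \<open>\<alpha> n 1\<close>; this keeps the coefficient of the extragradient loss away from
        0.\<close>
      have "(\<Sum>l\<in>{0,1}. \<alpha> n l) \<le> (\<Sum>l=0..M. \<alpha> n l)"
        using assms(5) by (intro sum_mono2) (use \<alpha>(1)[of _ n] in \<open>auto simp: less_imp_le\<close>)
      then have "c \<le> 1 - \<alpha> n 0" using elim \<alpha>(2)[of n] by simp
      then have "c * (\<delta> * (norm (x n - y n (i n)))\<^sup>2 + \<delta> * (norm (y n (i n) - zb n))\<^sup>2)
          \<le> (1 - \<alpha> n 0) * ((norm (x n - p0))\<^sup>2 - (norm (zb n - p0))\<^sup>2)"
        using key[OF iterate_in p0 i[of n]] \<delta> \<alpha>0[of n] unfolding zb_def by (intro mult_mono) auto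
      moreover have "0 \<le> \<alpha> n 1 * (norm (S 1 (zb n) - u n))\<^sup>2" using \<alpha>(1)[of 1 n] one by simp
      ultimately have "c * \<delta> * (norm (x n - y n (i n)))\<^sup>2 + c * \<delta> * (norm (y n (i n) - zb n))\<^sup>2 \<le> d n"
        using decrease[OF p0 one(1), of n] unfolding d_def by (simp add: algebra_simps)
      moreover have "0 \<le> c * \<delta> * (norm v)\<^sup>2" for v :: 'a using c(1) \<delta> by simp
      ultimately show ?case by (meson add_increasing add_increasing2 order_refl order_trans)
    qed
    then have "(\<lambda>n. x n - y n (i n)) \<longlonglongrightarrow> 0" "(\<lambda>n. y n (i n) - zb n) \<longlonglongrightarrow> 0"
      using c(1) \<delta>
      by (intro null_if_scaled_norm_sq_le_null[OF _ _ d0, of "c * \<delta>"]; simp add: eventually_conj_iff)+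
    then have "(\<lambda>n. - ((x n - y n (i n)) + (y n (i n) - zb n))) \<longlonglongrightarrow> - (0 + 0)"
      by (intro tendsto_intros)
    then show ?thesis by simp
  qed
  have y_null: "(\<lambda>n. x n - y n k) \<longlonglongrightarrow> 0" if k: "k \<in> {1..N}" for k
  proof -
    \<comment> \<open>The index \<open>i n\<close> maximises the displacement, so the single null
      sequence \<open>zb n - x n\<close> controls every \<open>k\<close>.\<close>
    have "(\<lambda>n. x n - z n k) \<longlonglongrightarrow> 0"
      using far[OF k]
      by (intro Lim_null_comparison[OF always_eventually tendsto_norm_zero[OF zb_null]])
        (simp add: zb_def norm_minus_commute)
    from norm_sq_diff_null[OF bdd this]
    have lim: "(\<lambda>n. (norm (x n - p0))\<^sup>2 - (norm (z n k - p0))\<^sup>2) \<longlonglongrightarrow> 0" .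
    have "\<delta> * (norm (x n - y n k))\<^sup>2 \<le> (norm (x n - p0))\<^sup>2 - (norm (z n k - p0))\<^sup>2" for n
    proof -
      have "0 \<le> \<delta> * (norm (y n k - z n k))\<^sup>2" using \<delta> by simp
      then show ?thesis using key[OF iterate_in p0 k, of n] by linarith
    qed
    then show ?thesis by (intro null_if_scaled_norm_sq_le_null[OF \<delta> _ lim] always_eventually allI)
  qed
  have fix_null: "(\<lambda>n. x n - S j (x n)) \<longlonglongrightarrow> 0" if j: "j \<in> {1..M}" for j
  proof -
    have "(\<lambda>n. S j (zb n) - S j (x n)) \<longlonglongrightarrow> 0"
      using S_le[OF j zbC iterate_in]
      by (intro Lim_null_comparison[OF always_eventually tendsto_norm_zero[OF zb_null]]) blast
    \<comment> \<open>Passes from \<open>x n\<close> to \<open>S j (x n)\<close> through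
      \<open>u n\<close> and \<open>S j (zb n)\<close>.\<close>
    then have "(\<lambda>n. (x n - u n) - (S j (zb n) - u n) + (S j (zb n) - S j (x n))) \<longlonglongrightarrow> 0 - 0 + 0"
      using residual_null S_null[OF j] by (intro tendsto_intros)
    then show ?thesis by simp
  qed
  have "x \<longlonglongrightarrow> metric_proj F (x 0)"
  proof (rule converges_to_projection)
    fix r p assume r: "strict_mono (r :: nat \<Rightarrow> nat)" and wlim: "weakly_converges (x \<circ> r) p"
    have p: "p \<in> C" using weakly_converges_closed_convex[OF C _ wlim] iterate_in by simp
    have null_r: "(\<lambda>n. a (r n)) \<longlonglongrightarrow> 0" if "a \<longlonglongrightarrow> (0::'a)" for a
      using LIMSEQ_subseq_LIMSEQ[OF that r] by (simp add: o_def)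
    have "S j p = p" if j: "j \<in> {1..M}" for j
      using nonexpansive_demiclosed[OF nonexp[OF j] _ p wlim, of "B0 + norm (x 0)"]
        iterate_in bdd[of _ 0] null_r[OF fix_null[OF j]] by simp
    moreover have "p \<in> EP C (f k)" if k: "k \<in> {1..N}" for k
    proof -
      define h where "h v w = real_of_ereal (f k v w)" for v w
      have fin: "f k v w = ereal (h v w)" if "v \<in> C" "w \<in> C" for v w
        unfolding h_def
        using subdifferentiable_bifunction_finite[OF bif[OF k] sub[OF k that(1)] that] .
      have ylim: "weakly_converges (\<lambda>n. y (r n) k) p"
        using weakly_converges_add_null[OF wlim] null_r[OF y_null[OF k]] by simp
      \<comment> \<open>Used with \<open>Y\<close> the sequence \<open>y (r n) k\<close> and with
        \<open>Y\<close> constantly \<open>v\<close>.\<close>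
      have wc: "(\<lambda>n. h (x (r n)) (Y n)) \<longlonglongrightarrow> h p v"
        if "\<And>n. Y n \<in> C" "v \<in> C" "weakly_converges Y v" for Y v
      proof -
        have "\<forall>n. (x \<circ> r) n \<in> C" using iterate_in by simp
        then have "(\<lambda>n. f k ((x \<circ> r) n) (Y n)) \<longlonglongrightarrow> f k p v"
          using wcont[OF k] p that wlim unfolding weakly_continuous_on_def by blast
        then show ?thesis using that p iterate_in by (simp add: fin)
      qed
      have "0 \<le> h p v" if v: "v \<in> C" for v
      proof -
        let ?g = "\<lambda>n. (norm (x (r n) - v))\<^sup>2 - (norm (y (r n) k - v))\<^sup>2"
        \<comment> \<open>The proximal inequality at \<open>v\<close> with the square of
          \<open>x (r n) - y (r n) k\<close> discarded; its limit reads
          \<open>\<rho> * h p p \<le> \<rho> * h p v\<close>, whose left side is 0.\<close>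
        have "\<rho> * h (x (r n)) (y (r n) k) \<le> \<rho> * h (x (r n)) v + 1/2 * ?g n" for n
        proof -
          have "0 \<le> 1/2 * (norm (x (r n) - y (r n) k))\<^sup>2" by simp
          then show ?thesis
            using prox_argmin_inequality[OF cvx[OF k iterate_in] fin[OF iterate_in] \<rho> y[OF k] v, of "r n"]
            unfolding norm_minus_commute[of v] right_diff_distrib by linarith
        qed
        moreover have "(\<lambda>n. \<rho> * h (x (r n)) (y (r n) k)) \<longlonglongrightarrow> \<rho> * h p p"
          using wc[OF yC[OF k] p ylim] by (intro tendsto_intros)
        moreover have "(\<lambda>n. \<rho> * h (x (r n)) v + 1/2 * ?g n) \<longlonglongrightarrow> \<rho> * h p v + 1/2 * 0"
          using wc[OF v v] norm_sq_diff_null[OF bdd null_r[OF y_null[OF k]]]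
          by (intro tendsto_intros) (auto simp: weakly_converges_def)
        ultimately have "\<rho> * h p p \<le> \<rho> * h p v + 1/2 * 0" by (intro LIMSEQ_le) auto
        moreover have "h p p = 0" using bif[OF k] p unfolding bifunction_on_def h_def by simp
        ultimately show ?thesis using \<rho> by (simp add: zero_le_mult_iff)
      qed
      then show ?thesis using p fin unfolding EP_def by simp
    qed
    ultimately show "p \<in> F" using p unfolding F_eq fixed_points_def by blast
  qed
  then show ?thesis unfolding x_0 .
qed

end
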